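(* Let $X$ be a weakly symmetric domain in $\mathbb{C}^n$ and let $F$ be a RKHS of holomorphic functions on $X$ such that $f\circ\Phi\in F$ for every $f\in F$ and every $\Phi\in Aut(X)$. Assume that there is a unitary-invariant Hermitean metric $\sigma$ on $F^*\setminus\{0\}$ which is invariant with respect to $C_\Phi^*$ for every automorphism $\Phi\in Aut(X)$. Then $F$ consists of constant functions.
   Context: A domain is an open connected set. $Aut(X)$ is the group of all biholomorphisms of $X$ onto itself. $X$ is weakly symmetric if for any $x,y\in X$ there is $\Phi\in Aut(X)$ with $\Phi(x)=y$ and $\Phi(y)=x$. A RKHS over $X$ is a Hilbert space $F$ of complex-valued functions on $X$ for which there is $K:X\times X\to\mathbb{C}$ with $K(\cdot,x)\in F$ and $f(x)=\langle f,K(\cdot,x)\rangle_F$ for all $x\in X$, $f\in F$. The dual $F^*$ is a Hilbert space with the inner product $\langle g^*,h^*\rangle_{F^*}=\langle h,g\rangle_F$, where $h^*=\langle\cdot,h\rangle_F$. For $\Phi\in Aut(X)$ the composition operator $C_\Phi:F\to F$, $C_\Phi f=f\circ\Phi$ (automatically bounded), has adjoint $C_\Phi^*:F^*\to F^*$, $C_\Phi^*l=l\circ C_\Phi$. A Hermitean metric on $G=F^*\setminus\{0\}$ is a smooth function $\sigma:G\times F^*\times F^*\to\mathbb{C}$ such that $\sigma_g=\sigma(g,\cdot,\cdot)$ is a conjugate-symmetric, sesquilinear, positive definite form on $F^*$ for every $g\in G$. It is invariant with respect to an injective linear operator $T$ on $F^*$ if $\sigma_{Tg}(Tf,Th)=\sigma_g(f,h)$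 for all $g\in G$, $f,h\in F^*$; it is unitary-invariant if it is invariant with respect to every unitary operator on $F^*$. *)

theory Defs
  imports "HOL-Analysis.Analysis" "HOL-Library.Function_Algebras"
begin

definition holomorphic_fun :: "(complex ^ 'n) set \<Rightarrow> (complex ^ 'n \<Rightarrow> complex) \<Rightarrow> bool" where
  "holomorphic_fun X f \<longleftrightarrow>
     (\<forall>x\<in>X. \<exists>D. (f has_derivative D) (at x) \<and> (\<forall>c v. D (c *s v) = c * D v))"

definition holomorphic_map :: "(complex ^ 'n) set \<Rightarrow> (complex ^ 'n \<Rightarrow> complex ^ 'm) \<Rightarrow> bool" where
  "holomorphic_map X \<Phi> \<longleftrightarrow> (\<forall>i. holomorphic_fun X (\<lambda>x. \<Phi> x $ i))"

text \<open>Elements of \<open>Aut X\<close> are represented by total functions; only their values on \<open>X\<close> matter.\<close>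

definition Aut :: "(complex ^ 'n) set \<Rightarrow> (complex ^ 'n \<Rightarrow> complex ^ 'n) set" where
  "Aut X = {\<Phi>. bij_betw \<Phi> X X \<and> holomorphic_map X \<Phi> \<and> holomorphic_map X (inv_into X \<Phi>)}"

definition weakly_symmetric :: "(complex ^ 'n) set \<Rightarrow> bool" where
  "weakly_symmetric X \<longleftrightarrow> (\<forall>x\<in>X. \<forall>y\<in>X. \<exists>\<Phi>\<in>Aut X. \<Phi> x = y \<and> \<Phi> y = x)"

text \<open>
  All Hilbert spaces below are given by a carrier set \<open>V\<close> of functions \<open>'a \<Rightarrow> complex\<close>, with
  pointwise operations, and an inner product that is relevant on \<open>V\<close> only. The functions on a
  set \<open>X\<close> are represented by total functions that vanish outside \<open>X\<close>, so that equality on \<open>X\<close>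
  is equality. Inner products are linear in the first argument.
\<close>

definition fscale :: "complex \<Rightarrow> ('a \<Rightarrow> complex) \<Rightarrow> ('a \<Rightarrow> complex)" where
  "fscale c f = (\<lambda>x. c * f x)"

lemma vector_space_fscale: "vector_space fscale"
  by unfold_locales (auto simp: fscale_def algebra_simps)

definition linear_on ::
  "(complex \<Rightarrow> 'a \<Rightarrow> 'a) \<Rightarrow> (complex \<Rightarrow> 'b \<Rightarrow> 'b) \<Rightarrow> 'a::ab_group_add set \<Rightarrow> ('a \<Rightarrow> 'b::ab_group_add) \<Rightarrow> bool"
  where
  "linear_on s1 s2 V T \<longleftrightarrow>
     (\<forall>f\<in>V. \<forall>g\<in>V. T (f + g) = T f + T g) \<and> (\<forall>c. \<forall>f\<in>V. T (s1 c f) = s2 c (T f))"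

definition sesquilinear_on ::
  "('a \<Rightarrow> complex) set \<Rightarrow> (('a \<Rightarrow> complex) \<Rightarrow> ('a \<Rightarrow> complex) \<Rightarrow> complex) \<Rightarrow> bool" where
  "sesquilinear_on V B \<longleftrightarrow>
     (\<forall>h\<in>V. linear_on fscale (*) V (\<lambda>f. B f h)) \<and>
     (\<forall>f\<in>V. linear_on fscale (\<lambda>c. (*) (cnj c)) V (\<lambda>h. B f h))"

definition pos_def_form_on ::
  "('a \<Rightarrow> complex) set \<Rightarrow> (('a \<Rightarrow> complex) \<Rightarrow> ('a \<Rightarrow> complex) \<Rightarrow> complex) \<Rightarrow> bool" where
  "pos_def_form_on V B \<longleftrightarrow>
     sesquilinear_on V B \<and>
     (\<forall>f\<in>V. \<forall>h\<in>V. B h f = cnj (B f h)) \<and>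
     (\<forall>f\<in>V. f \<noteq> 0 \<longrightarrow> B f f \<in> \<real> \<and> 0 < Re (B f f))"

definition ip_norm :: "('v \<Rightarrow> 'v \<Rightarrow> complex) \<Rightarrow> 'v \<Rightarrow> real" where
  "ip_norm ip f = sqrt (Re (ip f f))"

definition hilbert_on ::
  "('a \<Rightarrow> complex) set \<Rightarrow> (('a \<Rightarrow> complex) \<Rightarrow> ('a \<Rightarrow> complex) \<Rightarrow> complex) \<Rightarrow> bool" where
  "hilbert_on V ip \<longleftrightarrow>
     module.subspace fscale V \<and> pos_def_form_on V ip \<and>
     (\<forall>s :: nat \<Rightarrow> 'a \<Rightarrow> complex.
        range s \<subseteq> V \<and> (\<forall>e>0. \<exists>N. \<forall>m\<ge>N. \<forall>n\<ge>N. ip_norm ip (s m - s n) < e) \<longrightarrow>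
        (\<exists>f\<in>V. (\<lambda>n. ip_norm ip (s n - f)) \<longlonglongrightarrow> 0))"

definition rkhs ::
  "'x set \<Rightarrow> ('x \<Rightarrow> complex) set \<Rightarrow> (('x \<Rightarrow> complex) \<Rightarrow> ('x \<Rightarrow> complex) \<Rightarrow> complex) \<Rightarrow> bool" where
  "rkhs X F ip \<longleftrightarrow>
     hilbert_on F ip \<and> (\<forall>f\<in>F. \<forall>x. x \<notin> X \<longrightarrow> f x = 0) \<and>
     (\<exists>K :: 'x \<Rightarrow> 'x \<Rightarrow> complex. \<forall>x\<in>X. (\<lambda>y. K y x) \<in> F \<and> (\<forall>f\<in>F. f x = ip f (\<lambda>y. K y x)))"

text \<open>Functionals on \<open>V\<close> are likewise extended by \<open>0\<close> outside \<open>V\<close>.\<close>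

definition dual_space ::
  "('a \<Rightarrow> complex) set \<Rightarrow> (('a \<Rightarrow> complex) \<Rightarrow> ('a \<Rightarrow> complex) \<Rightarrow> complex) \<Rightarrow> (('a \<Rightarrow> complex) \<Rightarrow> complex) set"
  where
  "dual_space V ip =
     {l. (\<forall>f. f \<notin> V \<longrightarrow> l f = 0) \<and> linear_on fscale (*) V l \<and>
         (\<exists>C. \<forall>f\<in>V. cmod (l f) \<le> C * ip_norm ip f)}"

definition riesz ::
  "('a \<Rightarrow> complex) set \<Rightarrow> (('a \<Rightarrow> complex) \<Rightarrow> ('a \<Rightarrow> complex) \<Rightarrow> complex) \<Rightarrow>
   ('a \<Rightarrow> complex) \<Rightarrow> ('a \<Rightarrow> complex) \<Rightarrow> complex" where
  "riesz V ip h = (\<lambda>f. if f \<in> V then ip f h else 0)"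

text \<open>
  The inner product of the functionals represented by \<open>g\<close> and \<open>h\<close> is \<open>ip h g\<close>; see
  \<open>dual_ip_riesz\<close> below.
\<close>

definition dual_ip ::
  "('a \<Rightarrow> complex) set \<Rightarrow> (('a \<Rightarrow> complex) \<Rightarrow> ('a \<Rightarrow> complex) \<Rightarrow> complex) \<Rightarrow>
   (('a \<Rightarrow> complex) \<Rightarrow> complex) \<Rightarrow> (('a \<Rightarrow> complex) \<Rightarrow> complex) \<Rightarrow> complex" where
  "dual_ip V ip l m = ip (inv_into V (riesz V ip) m) (inv_into V (riesz V ip) l)"

lemma inj_on_riesz:
  assumes "hilbert_on V ip"
  shows "inj_on (riesz V ip) V"
proof (rule inj_onI)
  fix g h assume g: "g \<in> V" and h: "h \<in> V" and eq: "riesz V ip g = riesz V ip h"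
  have sub: "module.subspace fscale V" and pd: "pos_def_form_on V ip"
    using assms by (auto simp: hilbert_on_def)
  interpret vector_space fscale by (rule vector_space_fscale)
  have d: "g - h \<in> V" using sub g h by (rule subspace_diff)
  have same: "ip (g - h) g = ip (g - h) h"
    using fun_cong[OF eq, of "g - h"] d by (simp only: riesz_def if_True)
  have "\<forall>f\<in>V. linear_on fscale (\<lambda>c. (*) (cnj c)) V (\<lambda>k. ip f k)"
    using pd unfolding pos_def_form_on_def sesquilinear_on_def by (elim conjE)
  from bspec[OF this d] have "\<forall>f\<in>V. \<forall>k\<in>V. ip (g - h) (f + k) = ip (g - h) f + ip (g - h) k"
    unfolding linear_on_def by (elim conjE)
  from bspec[OF bspec[OF this d] h] have "ip (g - h) (g - h) = 0"
    using same by (simp only: diff_add_cancel) (metis add_cancel_left_left)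
  moreover have "\<forall>f\<in>V. f \<noteq> 0 \<longrightarrow> ip f f \<in> \<real> \<and> 0 < Re (ip f f)"
    using pd unfolding pos_def_form_on_def by (elim conjE)
  ultimately have "g - h = 0" using d by (metis less_irrefl zero_complex.sel(1))
  then show "g = h" by simp
qed

lemma dual_ip_riesz:
  assumes "hilbert_on V ip" "g \<in> V" "h \<in> V"
  shows "dual_ip V ip (riesz V ip g) (riesz V ip h) = ip h g"
  using assms inj_on_riesz[OF assms(1)] by (simp add: dual_ip_def)

definition composition_op ::
  "'x set \<Rightarrow> ('x \<Rightarrow> 'x) \<Rightarrow> ('x \<Rightarrow> complex) \<Rightarrow> ('x \<Rightarrow> complex)" where
  "composition_op X \<Phi> f = (\<lambda>x. if x \<in> X then f (\<Phi> x) else 0)"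

definition adjoint_op ::
  "('a \<Rightarrow> complex) set \<Rightarrow> (('a \<Rightarrow> complex) \<Rightarrow> ('a \<Rightarrow> complex)) \<Rightarrow>
   (('a \<Rightarrow> complex) \<Rightarrow> complex) \<Rightarrow> (('a \<Rightarrow> complex) \<Rightarrow> complex)" where
  "adjoint_op V T l = (\<lambda>f. if f \<in> V then l (T f) else 0)"

definition unitary_on ::
  "('a \<Rightarrow> complex) set \<Rightarrow> (('a \<Rightarrow> complex) \<Rightarrow> ('a \<Rightarrow> complex) \<Rightarrow> complex) \<Rightarrow>
   (('a \<Rightarrow> complex) \<Rightarrow> ('a \<Rightarrow> complex)) \<Rightarrow> bool" where
  "unitary_on V ip U \<longleftrightarrow>
     linear_on fscale fscale V U \<and> bij_betw U V V \<and> (\<forall>f\<in>V. \<forall>g\<in>V. ip (U f) (U g) = ip f g)"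

text \<open>
  Real \<open>C\<^sup>\<infinity>\<close> smoothness, in the sense of Frechet, of a function on an open subset \<open>U\<close> of a normed
  space with carrier \<open>V\<close>, real scaling \<open>sc\<close> and norm \<open>N\<close>. Here \<open>D x [v\<^sub>1, \<dots>, v\<^sub>k]\<close> is the \<open>k\<close>-th
  derivative at \<open>x\<close>, a bounded \<open>k\<close>-linear form. The estimate says that \<open>h \<mapsto> D x (h # _)\<close> is the
  derivative at \<open>x\<close> of the map \<open>x \<mapsto> D x\<close> into the \<open>k\<close>-linear forms with the operator norm.
\<close>

definition bounded_multilinear_on ::
  "'v::ab_group_add set \<Rightarrow> (real \<Rightarrow> 'v \<Rightarrow> 'v) \<Rightarrow> ('v \<Rightarrow> real) \<Rightarrow> nat \<Rightarrow> ('v list \<Rightarrow> complex) \<Rightarrow> bool" where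
  "bounded_multilinear_on V sc N k M \<longleftrightarrow>
     (\<forall>vs\<in>lists V. length vs = k \<longrightarrow> (\<forall>i<k.
        (\<forall>a\<in>V. \<forall>b\<in>V. M (vs[i := a + b]) = M (vs[i := a]) + M (vs[i := b])) \<and>
        (\<forall>r. \<forall>a\<in>V. M (vs[i := sc r a]) = complex_of_real r * M (vs[i := a])))) \<and>
     (\<exists>C. \<forall>vs\<in>lists V. length vs = k \<longrightarrow> cmod (M vs) \<le> C * prod_list (map N vs))"

definition smooth_fun_on ::
  "'v::ab_group_add set \<Rightarrow> (real \<Rightarrow> 'v \<Rightarrow> 'v) \<Rightarrow> ('v \<Rightarrow> real) \<Rightarrow> 'v set \<Rightarrow> ('v \<Rightarrow> complex) \<Rightarrow> bool" where
  "smooth_fun_on V sc N U f \<longleftrightarrow>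
     (\<exists>D :: 'v \<Rightarrow> 'v list \<Rightarrow> complex.
        (\<forall>x\<in>U. D x [] = f x) \<and>
        (\<forall>k. \<forall>x\<in>U.
           bounded_multilinear_on V sc N k (D x) \<and>
           (\<forall>e>0. \<exists>d>0. \<forall>h\<in>V. N h < d \<and> x + h \<in> U \<longrightarrow>
              (\<forall>vs\<in>lists V. length vs = k \<longrightarrow>
                 cmod (D (x + h) vs - D x vs - D x (h # vs)) \<le> e * N h * prod_list (map N vs)))))"

definition scale3 ::
  "real \<Rightarrow> ('a \<Rightarrow> complex) \<times> ('a \<Rightarrow> complex) \<times> ('a \<Rightarrow> complex) \<Rightarrow>
   ('a \<Rightarrow> complex) \<times> ('a \<Rightarrow> complex) \<times> ('a \<Rightarrow> complex)" where
  "scale3 r = (\<lambda>(f, g, h). (fscale (complex_of_real r) f, fscale (complex_of_real r) g,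
     fscale (complex_of_real r) h))"

definition norm3 :: "('v \<Rightarrow> 'v \<Rightarrow> complex) \<Rightarrow> 'v \<times> 'v \<times> 'v \<Rightarrow> real" where
  "norm3 ip = (\<lambda>(f, g, h). sqrt ((ip_norm ip f)\<^sup>2 + (ip_norm ip g)\<^sup>2 + (ip_norm ip h)\<^sup>2))"

definition hermitean_metric ::
  "('a \<Rightarrow> complex) set \<Rightarrow> (('a \<Rightarrow> complex) \<Rightarrow> ('a \<Rightarrow> complex) \<Rightarrow> complex) \<Rightarrow>
   (('a \<Rightarrow> complex) \<Rightarrow> ('a \<Rightarrow> complex) \<Rightarrow> ('a \<Rightarrow> complex) \<Rightarrow> complex) \<Rightarrow> bool" where
  "hermitean_metric W ip \<sigma> \<longleftrightarrow>
     smooth_fun_on (W \<times> W \<times> W) scale3 (norm3 ip) ((W - {0}) \<times> W \<times> W) (\<lambda>(g, f, h). \<sigma> g f h) \<and>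
     (\<forall>g\<in>W - {0}. pos_def_form_on W (\<sigma> g))"

definition metric_invariant ::
  "('a \<Rightarrow> complex) set \<Rightarrow> (('a \<Rightarrow> complex) \<Rightarrow> ('a \<Rightarrow> complex) \<Rightarrow> ('a \<Rightarrow> complex) \<Rightarrow> complex) \<Rightarrow>
   (('a \<Rightarrow> complex) \<Rightarrow> ('a \<Rightarrow> complex)) \<Rightarrow> bool" where
  "metric_invariant W \<sigma> T \<longleftrightarrow>
     (\<forall>g\<in>W - {0}. \<forall>f\<in>W. \<forall>h\<in>W. \<sigma> (T g) (T f) (T h) = \<sigma> g f h)"

definition unitary_invariant ::
  "('a \<Rightarrow> complex) set \<Rightarrow> (('a \<Rightarrow> complex) \<Rightarrow> ('a \<Rightarrow> complex) \<Rightarrow> complex) \<Rightarrow>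
   (('a \<Rightarrow> complex) \<Rightarrow> ('a \<Rightarrow> complex) \<Rightarrow> ('a \<Rightarrow> complex) \<Rightarrow> complex) \<Rightarrow> bool" where
  "unitary_invariant W ip \<sigma> \<longleftrightarrow> (\<forall>U. unitary_on W ip U \<longrightarrow> metric_invariant W \<sigma> U)"

end

theory Submission
  imports Defs "HOL-Complex_Analysis.Complex_Analysis"
begin

text \<open>
  Let \<open>K\<close> be the reproducing kernel and \<open>\<delta>\<^sub>x\<close> the evaluation at \<open>x\<close>; then \<open>C\<^sub>\<Phi>\<^sup>*\<close> maps \<open>\<delta>\<^sub>x\<close> to
  \<open>\<delta>\<close> at \<open>\<Phi> x\<close>. Unitary invariance under the reflection in the line of \<open>g\<close> gives
  \<open>\<sigma>\<^sub>g(h, g) = \<langle>h, g\<rangle> / \<langle>g, g\<rangle> \<cdot> \<sigma>\<^sub>g(g, g)\<close>. An automorphism that exchanges \<open>x\<close> and \<open>y\<close> exchanges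
  \<open>g = \<delta>\<^sub>x\<close> and \<open>h = \<delta>\<^sub>y\<close>, so \<open>\<sigma>\<^sub>g(g, g) = \<sigma>\<^sub>h(h, h)\<close> and \<open>\<sigma>\<^sub>g(h, g) = \<sigma>\<^sub>h(g, h)\<close>; comparing absolute values,
  \<open>K(x, x) = K(y, y)\<close> whenever \<open>K(x, y) \<noteq> 0\<close>. Hence \<open>K(x, x)\<close> is locally constant and thus a
  constant \<open>c\<close>. By Cauchy-Schwarz \<open>\<bar>K(\<cdot>, y)\<bar> \<le> c = K(y, y)\<close>, so by the maximum principle \<open>K(x, y) = c\<close>
  for \<open>x\<close> near \<open>y\<close>, which means \<open>\<parallel>\<delta>\<^sub>x - \<delta>\<^sub>y\<parallel> = 0\<close>: all functions in \<open>F\<close> are locally constant.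
\<close>

section \<open>Positive definite forms and reflections\<close>

interpretation fspace: vector_space fscale
  by (rule vector_space_fscale)

text \<open>It serves the inner product of \<open>F\<close>, that of the dual, and the forms
  \<open>\<sigma> g\<close> on the dual; completeness is left to
  \<open>hilbert_space\<close>.\<close>

locale pos_def_space =
  fixes V :: "('a \<Rightarrow> complex) set" and B :: "('a \<Rightarrow> complex) \<Rightarrow> ('a \<Rightarrow> complex) \<Rightarrow> complex"
  assumes subspace: "fspace.subspace V" and pos_def: "pos_def_form_on V B"
begin

lemma zero_mem [simp]: "0 \<in> V"
  using fspace.subspace_0[OF subspace] .

lemma add_mem [simp]: "f \<in> V \<Longrightarrow> g \<in> V \<Longrightarrow> f + g \<in> V"
  using fspace.subspace_add[OF subspace] .

lemma diff_mem [simp]: "f \<in> V \<Longrightarrow> g \<in> V \<Longrightarrow> f - g \<in> V"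
  using fspace.subspace_diff[OF subspace] .

lemma scale_mem [simp]: "f \<in> V \<Longrightarrow> fscale c f \<in> V"
  using fspace.subspace_scale[OF subspace] .

lemma linear_left: "h \<in> V \<Longrightarrow> linear_on fscale (*) V (\<lambda>f. B f h)"
  and linear_right: "h \<in> V \<Longrightarrow> linear_on fscale (\<lambda>c. (*) (cnj c)) V (B h)"
  using pos_def by (simp_all add: pos_def_form_on_def sesquilinear_on_def)

lemma
  assumes "f \<in> V" "g \<in> V" "h \<in> V"
  shows form_add_left: "B (f + g) h = B f h + B g h"
    and form_add_right: "B h (f + g) = B h f + B h g"
  using linear_left[OF assms(3)] linear_right[OF assms(3)] assms by (simp_all add: linear_on_def)

lemma
  assumes "f \<in> V" "h \<in> V"
  shows form_scale_left: "B (fscale c f) h = c * B f h"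
    and form_scale_right: "B h (fscale c f) = cnj c * B h f"
  using linear_left[OF assms(2)] linear_right[OF assms(2)] assms by (simp_all add: linear_on_def)

lemma form_cnj:
  assumes "f \<in> V" "h \<in> V"
  shows "B h f = cnj (B f h)"
proof -
  have "\<forall>f\<in>V. \<forall>h\<in>V. B h f = cnj (B f h)"
    using pos_def unfolding pos_def_form_on_def by (elim conjE)
  from bspec[OF bspec[OF this assms(1)] assms(2)] show ?thesis .
qed

lemma
  assumes "f \<in> V" "g \<in> V" "h \<in> V"
  shows form_diff_left: "B (f - g) h = B f h - B g h"
    and form_diff_right: "B h (f - g) = B h f - B h g"
  using form_add_left[of "f - g" g h] form_add_right[of "f - g" g h] assms by simp_all

lemma form_zero [simp]: "h \<in> V \<Longrightarrow> B 0 h = 0" "h \<in> V \<Longrightarrow> B h 0 = 0"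
  using form_diff_left[of h h h] form_diff_right[of h h h] by simp_all

lemma form_self: "f \<in> V \<Longrightarrow> B f f = of_real (Re (B f f))"
  using arg_cong[OF form_cnj[of f f], of Im] by (simp add: complex_eq_iff)

lemma form_self_pos:
  assumes "f \<in> V" "f \<noteq> 0"
  shows "0 < Re (B f f)"
proof -
  have "\<forall>f\<in>V. f \<noteq> 0 \<longrightarrow> B f f \<in> \<real> \<and> 0 < Re (B f f)"
    using pos_def unfolding pos_def_form_on_def by (elim conjE)
  from bspec[OF this assms(1)] show ?thesis using assms(2) by blast
qed

lemma form_self_nonneg: "f \<in> V \<Longrightarrow> 0 \<le> Re (B f f)"
  using form_self_pos[of f] by (cases "f = 0") auto

lemma form_self_eq_0_iff: "f \<in> V \<Longrightarrow> B f f = 0 \<longleftrightarrow> f = 0"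
  using form_self_pos[of f] by (cases "f = 0") auto

lemma cnj_form_self [simp]: "f \<in> V \<Longrightarrow> cnj (B f f) = B f f"
  using form_cnj[of f f] by (rule sym)

lemmas form_simps = form_add_left form_add_right form_diff_left form_diff_right
  form_scale_left form_scale_right

text \<open>Pythagoras: \<open>w\<close> is \<open>f\<close> minus its orthogonal projection onto
  the line of \<open>h\<close>. Nonnegativity of the left side yields Cauchy-Schwarz; the drop in
  norm yields orthogonality in \<open>riesz_representation\<close>.\<close>

lemma form_self_diff_projection:
  assumes f: "f \<in> V" and h: "h \<in> V" "h \<noteq> 0"
  defines "w \<equiv> f - fscale (B f h / B h h) h"
  shows "Re (B w w) = Re (B f f) - (cmod (B f h))\<^sup>2 / Re (B h h)"
proof -
  define r where "r = Re (B h h)"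
  have r: "B h h = of_real r" "r > 0"
    unfolding r_def using form_self[OF h(1)] form_self_pos[OF h] by blast+
  have "B w w = B f f - B f h * cnj (B f h) / of_real r"
    using r f h form_cnj[of f h] by (simp add: w_def form_simps field_simps)
  also have "B f h * cnj (B f h) = of_real ((cmod (B f h))\<^sup>2)"
    by (rule complex_norm_square[symmetric])
  finally show ?thesis
    by (simp flip: of_real_divide add: r_def)
qed

lemma Cauchy_Schwarz:
  assumes f: "f \<in> V" and h: "h \<in> V"
  shows "(cmod (B f h))\<^sup>2 \<le> Re (B f f) * Re (B h h)"
proof (cases "h = 0")
  case False
  have "0 \<le> Re (B f f) - (cmod (B f h))\<^sup>2 / Re (B h h)"
    using form_self_diff_projection[OF f h False] form_self_nonneg[of "f - fscale (B f h / B h h) h"]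
      f h by simp
  then show ?thesis
    using form_self_pos[OF h False] by (simp add: field_simps)
qed (use f in simp)

lemma ip_norm_nonneg: "f \<in> V \<Longrightarrow> 0 \<le> ip_norm B f"
  by (simp add: ip_norm_def form_self_nonneg)

lemma ip_norm_power2: "f \<in> V \<Longrightarrow> (ip_norm B f)\<^sup>2 = Re (B f f)"
  by (simp add: ip_norm_def form_self_nonneg)

lemma form_le_ip_norm:
  assumes "f \<in> V" "h \<in> V"
  shows "cmod (B f h) \<le> ip_norm B f * ip_norm B h"
  by (rule power2_le_imp_le)
    (use assms Cauchy_Schwarz[OF assms] in \<open>simp_all add: power_mult_distrib ip_norm_power2 ip_norm_nonneg\<close>)

lemma ip_norm_triangle_diff:
  assumes f: "f \<in> V" and h: "h \<in> V"
  shows "ip_norm B (f - h) \<le> ip_norm B f + ip_norm B h"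
proof (rule power2_le_imp_le)
  have "Re (B (f - h) (f - h)) = Re (B f f) + Re (B h h) - 2 * Re (B f h)"
    using f h form_cnj[of f h] by (simp add: form_simps)
  moreover have "- Re (B f h) \<le> ip_norm B f * ip_norm B h"
    using form_le_ip_norm[OF f h] abs_Re_le_cmod[of "B f h"] by linarith
  ultimately show "(ip_norm B (f - h))\<^sup>2 \<le> (ip_norm B f + ip_norm B h)\<^sup>2"
    using f h by (simp add: ip_norm_power2 power2_sum)
qed (use f h in \<open>simp add: ip_norm_nonneg\<close>)

text \<open>The law is written with the midpoint because the midpoint of two elements of the
  hyperplane \<open>l h = 1\<close> stays in it, which bounds the last term in
  \<open>minimal_element\<close>.\<close>

lemma parallelogram:
  assumes "f \<in> V" "h \<in> V"
  shows "Re (B (f - h) (f - h)) =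
    2 * Re (B f f) + 2 * Re (B h h) - 4 * Re (B (fscale (1/2) (f + h)) (fscale (1/2) (f + h)))"
  using assms by (simp add: form_simps field_simps)

text \<open>The map is twice the orthogonal projection onto the line of \<open>g\<close>, minus the
  identity. It is its own inverse, hence bijective.\<close>

lemma unitary_on_reflection:
  assumes g: "g \<in> V" "g \<noteq> 0"
  shows "unitary_on V B (\<lambda>f. fscale (2 * B f g / B g g) g - f)" (is "unitary_on V B ?U")
proof -
  have gg: "B g g \<noteq> 0"
    using g form_self_eq_0_iff by blast
  have mem: "?U f \<in> V" if "f \<in> V" for f
    using g that by simp
  have involutive: "?U (?U f) = f" if f: "f \<in> V" for f
  proof -
    \<comment> \<open>The component along \<open>g\<close> is kept, so the second reflection
      subtracts from the same multiple of \<open>g\<close>.\<close>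
    have "B (?U f) g = B f g"
      using f g gg by (simp add: form_simps)
    then show ?thesis by simp
  qed
  have "linear_on fscale fscale V ?U"
    unfolding linear_on_def
  proof (intro conjI ballI allI)
    fix f h assume "f \<in> V" "h \<in> V"
    then show "?U (f + h) = ?U f + ?U h"
      using g by (simp add: form_simps fscale_def fun_eq_iff add_divide_distrib algebra_simps)
  next
    fix c f assume "f \<in> V"
    then show "?U (fscale c f) = fscale c (?U f)"
      using form_scale_left[of f g c] g by (simp add: fscale_def fun_eq_iff algebra_simps)
  qed
  moreover have "bij_betw ?U V V"
    by (rule bij_betw_byWitness[where f' = ?U]) (use involutive mem in blast)+
  moreover have "B (?U f) (?U h) = B f h" if f: "f \<in> V" and h: "h \<in> V" for f h
    using f h g gg form_cnj[of g h] by (simp add: form_simps field_simps)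
  ultimately show ?thesis
    unfolding unitary_on_def by blast
qed

text \<open>The reflection fixes \<open>g\<close> and is \<open>-1\<close> on its orthogonal complement, so \<open>\<sigma>\<^sub>g\<close> makes \<open>g\<close>
  orthogonal to that complement, too.\<close>

lemma unitary_invariant_form:
  assumes inv: "unitary_invariant V B \<sigma>" and \<sigma>: "pos_def_form_on V (\<sigma> g)"
    and g: "g \<in> V" "g \<noteq> 0" and h: "h \<in> V"
  shows "\<sigma> g h g = B h g / B g g * \<sigma> g g g"
proof -
  interpret \<sigma>: pos_def_space V "\<sigma> g"
    by unfold_locales (rule subspace \<sigma>)+
  define U where "U = (\<lambda>f. fscale (2 * B f g / B g g) g - f)"
  have gg: "B g g \<noteq> 0"
    using g form_self_eq_0_iff by blast
  have Ug: "U g = g"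
    using gg by (simp add: U_def fscale_def fun_eq_iff)
  have "metric_invariant V \<sigma> U"
    using inv unitary_on_reflection[OF g] by (simp add: unitary_invariant_def U_def)
  then have "\<sigma> (U g) (U h) (U g) = \<sigma> g h g"
    using g h by (simp add: metric_invariant_def)
  \<comment> \<open>Expanding \<open>U h\<close> in the first argument turns invariance into
    \<open>2 * (B h g / B g g * \<sigma> g g g) - \<sigma> g h g = \<sigma> g h g\<close>.\<close>
  then have "2 * (B h g / B g g * \<sigma> g g g) = 2 * \<sigma> g h g"
    using g h unfolding Ug by (simp add: U_def \<sigma>.form_simps mult.assoc)
  then show ?thesis
    by (metis mult_left_cancel zero_neq_numeral)
qed

end

section \<open>Completeness, Riesz representation and the dual space\<close>

locale hilbert_space = pos_def_space +
  assumes complete: "\<And>s :: nat \<Rightarrow> 'a \<Rightarrow> complex. range s \<subseteq> V \<Longrightarrow>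
    \<forall>e>0. \<exists>N. \<forall>m\<ge>N. \<forall>n\<ge>N. ip_norm B (s m - s n) < e \<Longrightarrow>
    \<exists>f\<in>V. (\<lambda>n. ip_norm B (s n - f)) \<longlonglongrightarrow> 0"

lemma hilbert_space_if_hilbert_on: "hilbert_on V ip \<Longrightarrow> hilbert_space V ip"
  by unfold_locales (auto simp: hilbert_on_def)

context hilbert_space
begin

text \<open>A minimizing sequence in the hyperplane \<open>l h = 1\<close> is Cauchy by the
  parallelogram law; its limit stays in the hyperplane because \<open>l\<close> is bounded.\<close>

lemma minimal_element:
  assumes l: "linear_on fscale (*) V l" and C: "\<And>f. f \<in> V \<Longrightarrow> cmod (l f) \<le> C * ip_norm B f"
    and k: "k \<in> V" "l k = 1"
  obtains f where "f \<in> V" "l f = 1" "\<And>h. h \<in> V \<Longrightarrow> l h = 1 \<Longrightarrow> Re (B f f) \<le> Re (B h h)"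
proof -
  have l_add: "l (f + h) = l f + l h" if "f \<in> V" "h \<in> V" for f h
    using l that unfolding linear_on_def by blast
  have l_scale: "l (fscale c f) = c * l f" if "f \<in> V" for f c
    using l that unfolding linear_on_def by blast
  have l_diff: "l (f - h) = l f - l h" if "f \<in> V" "h \<in> V" for f h
    using l_add[of "f - h" h] that by simp
  define S where "S = {f \<in> V. l f = 1}"
  define d where "d = (INF f\<in>S. Re (B f f))"
  have bdd: "bdd_below ((\<lambda>f. Re (B f f)) ` S)"
    by (rule bdd_belowI[of _ 0]) (auto simp: S_def form_self_nonneg)
  have S: "k \<in> S"
    using k by (simp add: S_def)
  have d_le: "d \<le> Re (B f f)" if "f \<in> S" for f
    unfolding d_def by (rule cINF_lower[OF bdd that])
  have "\<exists>f\<in>S. Re (B f f) < d + inverse (real (Suc n))" for n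
  proof -
    have "d < d + inverse (real (Suc n))" by simp
    then show ?thesis
      unfolding d_def using cINF_less_iff[OF _ bdd] S by blast
  qed
  then obtain s where s: "\<And>n. s n \<in> S" "\<And>n. Re (B (s n) (s n)) < d + inverse (real (Suc n))"
    by metis
  have sV: "s n \<in> V" and ls: "l (s n) = 1" for n
    using s(1)[of n] by (auto simp: S_def)
  have dist: "Re (B (s m - s n) (s m - s n)) \<le> 2 * inverse (real (Suc m)) + 2 * inverse (real (Suc n))" for m n
  proof -
    \<comment> \<open>The midpoint contributes at least \<open>4 * d\<close>, which cancels the
      \<open>2 * d\<close> from each of \<open>s m\<close> and \<open>s n\<close>.\<close>
    have "fscale (1/2) (s m + s n) \<in> S"
      using sV ls by (simp add: S_def l_add l_scale)
    from d_le[OF this] show ?thesis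
      using parallelogram[OF sV[of m] sV[of n]] s(2)[of m] s(2)[of n] by linarith
  qed
  have "\<exists>f\<in>V. (\<lambda>n. ip_norm B (s n - f)) \<longlonglongrightarrow> 0"
  proof (rule complete)
    show "\<forall>e>0. \<exists>N. \<forall>m\<ge>N. \<forall>n\<ge>N. ip_norm B (s m - s n) < e"
    proof (intro allI impI)
      fix e :: real assume e: "e > 0"
      \<comment> \<open>By \<open>dist\<close>, each of the two terms is then below
        \<open>e\<^sup>2 / 2\<close>.\<close>
      obtain N where N: "inverse (real (Suc N)) < e\<^sup>2 / 4"
        using reals_Archimedean[of "e\<^sup>2 / 4"] e by auto
      have "ip_norm B (s m - s n) < e" if "m \<ge> N" "n \<ge> N" for m n
      proof (rule power2_less_imp_less)
        have "inverse (real (Suc m)) \<le> inverse (real (Suc N))"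
          "inverse (real (Suc n)) \<le> inverse (real (Suc N))"
          using that by (auto intro!: le_imp_inverse_le)
        then show "(ip_norm B (s m - s n))\<^sup>2 < e\<^sup>2"
          unfolding ip_norm_power2[OF diff_mem[OF sV sV]] using dist[of m n] N by linarith
      qed (use e in simp)
      then show "\<exists>N. \<forall>m\<ge>N. \<forall>n\<ge>N. ip_norm B (s m - s n) < e" by blast
    qed
  qed (use sV in blast)
  then obtain f where f: "f \<in> V" and lim: "(\<lambda>n. ip_norm B (s n - f)) \<longlonglongrightarrow> 0"
    by blast
  have "l f = 1"
  proof -
    \<comment> \<open>Here \<open>1 - l f\<close> is \<open>l (s n - f)\<close>.\<close>
    have "cmod (1 - l f) \<le> C * ip_norm B (s n - f)" for n
      using C[of "s n - f"] sV f by (simp add: l_diff ls)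
    moreover have "(\<lambda>n. C * ip_norm B (s n - f)) \<longlonglongrightarrow> 0"
      using tendsto_mult_left[OF lim, of C] by simp
    ultimately have "cmod (1 - l f) \<le> 0"
      by (meson LIMSEQ_le_const)
    then show ?thesis by simp
  qed
  moreover have "Re (B f f) \<le> d"
  proof -
    have d0: "0 \<le> d"
      unfolding d_def by (rule cINF_greatest) (use S in \<open>auto simp: S_def form_self_nonneg\<close>)
    \<comment> \<open>Write \<open>f\<close> as \<open>s n - (s n - f)\<close>; then let
      \<open>n\<close> tend to infinity.\<close>
    have "ip_norm B f \<le> sqrt (d + inverse (real (Suc n))) + ip_norm B (s n - f)" for n
    proof -
      have "ip_norm B f \<le> ip_norm B (s n) + ip_norm B (s n - f)"
        using ip_norm_triangle_diff[of "s n" "s n - f"] sV f by simp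
      moreover have "ip_norm B (s n) \<le> sqrt (d + inverse (real (Suc n)))"
        unfolding ip_norm_def using s(2)[of n] by simp
      ultimately show ?thesis by simp
    qed
    moreover have "(\<lambda>n. sqrt (d + inverse (real (Suc n))) + ip_norm B (s n - f)) \<longlonglongrightarrow> sqrt (d + 0) + 0"
      by (intro tendsto_intros lim LIMSEQ_inverse_real_of_nat)
    ultimately have "ip_norm B f \<le> sqrt d"
      using LIMSEQ_le_const[of _ "sqrt (d + 0) + 0" "ip_norm B f"] by auto
    then show ?thesis
      by (simp add: ip_norm_def)
  qed
  ultimately show ?thesis
    using that f d_le by (force simp: S_def)
qed

text \<open>For nonzero \<open>l\<close>, the element of least norm with \<open>l f = 1\<close> is
  orthogonal to the kernel of \<open>l\<close>, so a multiple of it represents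
  \<open>l\<close>.\<close>

lemma riesz_representation:
  assumes "l \<in> dual_space V B"
  shows "l \<in> riesz V B ` V"
proof (cases "\<forall>f\<in>V. l f = 0")
  case True
  then have "l = riesz V B 0"
    using assms by (auto simp: dual_space_def riesz_def fun_eq_iff)
  then show ?thesis by simp
next
  case False
  have l0: "l f = 0" if "f \<notin> V" for f
    using assms that by (simp add: dual_space_def)
  have l: "linear_on fscale (*) V l"
    using assms by (simp add: dual_space_def)
  have l_add: "l (f + h) = l f + l h" if "f \<in> V" "h \<in> V" for f h
    using l that unfolding linear_on_def by blast
  have l_scale: "l (fscale c f) = c * l f" if "f \<in> V" for f c
    using l that unfolding linear_on_def by blast
  have l_diff: "l (f - h) = l f - l h" if "f \<in> V" "h \<in> V" for f h
    using l_add[of "f - h" h] that by simp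
  obtain C where C: "\<And>f. f \<in> V \<Longrightarrow> cmod (l f) \<le> C * ip_norm B f"
    using assms by (auto simp: dual_space_def)
  obtain k where "k \<in> V" "l k \<noteq> 0"
    using False by blast
  then have "fscale (1 / l k) k \<in> V" "l (fscale (1 / l k) k) = 1"
    by (auto simp: l_scale)
  from minimal_element[OF l C this]
  obtain f where f: "f \<in> V" "l f = 1" "\<And>h. h \<in> V \<Longrightarrow> l h = 1 \<Longrightarrow> Re (B f f) \<le> Re (B h h)"
    by blast
  have "f \<noteq> 0"
    using f l_diff[of f f] by auto
  then have ff: "B f f \<noteq> 0"
    using f form_self_eq_0_iff by blast
  \<comment> \<open>Subtracting the projection onto \<open>h\<close> leaves the value of
    \<open>l\<close> at 1, so by minimality it cannot lower the norm.\<close>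
  have orth: "B f h = 0" if h: "h \<in> V" "l h = 0" for h
  proof (cases "h = 0")
    case False
    have "(cmod (B f h))\<^sup>2 / Re (B h h) \<le> 0"
      using f(3)[of "f - fscale (B f h / B h h) h"] form_self_diff_projection[OF f(1) h(1) False] f h
      by (simp add: l_diff l_scale)
    then show ?thesis
      using form_self_pos[OF h(1) False] by (simp add: divide_le_0_iff)
  qed (use f in simp)
  \<comment> \<open>Since \<open>h - fscale (l h) f\<close> lies in the kernel,
    \<open>B h f = l h * B f f\<close>. The scalar is conjugated because it leaves the second
    argument of \<open>B\<close> as its conjugate.\<close>
  have "l h = riesz V B (fscale (1 / cnj (B f f)) f) h" for h
  proof (cases "h \<in> V")
    case True
    have "B f (h - fscale (l h) f) = 0"
      by (rule orth) (use True f in \<open>simp_all add: l_diff l_scale\<close>)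
    then have "B f h = cnj (l h) * B f f"
      using True f by (simp add: form_simps)
    then have "B h f = l h * B f f"
      using form_cnj[of f h] True f by simp
    then show ?thesis
      using True f ff by (simp add: riesz_def form_simps)
  qed (simp add: l0 riesz_def)
  then have "l = riesz V B (fscale (1 / cnj (B f f)) f)"
    by blast
  then show ?thesis using f by simp
qed

lemma riesz_mem:
  assumes "g \<in> V"
  shows "riesz V B g \<in> dual_space V B"
proof -
  have "cmod (riesz V B g f) \<le> ip_norm B g * ip_norm B f" if "f \<in> V" for f
    using form_le_ip_norm[OF that assms] that by (simp add: riesz_def mult.commute)
  then show ?thesis
    using assms unfolding dual_space_def linear_on_def
    by (auto simp: riesz_def form_simps)
qed

lemma dual_space_eq_riesz_image: "dual_space V B = riesz V B ` V"
  using riesz_representation riesz_mem by blast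

lemma riesz_add: "f \<in> V \<Longrightarrow> g \<in> V \<Longrightarrow> riesz V B f + riesz V B g = riesz V B (f + g)"
  by (auto simp: riesz_def form_simps fun_eq_iff)

lemma riesz_scale: "f \<in> V \<Longrightarrow> fscale c (riesz V B f) = riesz V B (fscale (cnj c) f)"
  unfolding fscale_def[of c "riesz V B f"] by (auto simp: riesz_def form_simps fun_eq_iff)

lemma riesz_zero: "riesz V B 0 = 0"
  by (auto simp: riesz_def)

lemma hilbert_on: "hilbert_on V B"
  unfolding hilbert_on_def using subspace pos_def complete by blast

text \<open>All functionals are of the form \<open>riesz V B f\<close>. The Riesz map is conjugate
  linear, and the swapped arguments in \<open>dual_ip\<close> restore linearity in the first
  argument.\<close>

lemma pos_def_space_dual: "pos_def_space (dual_space V B) (dual_ip V B)"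
proof
  note ip = dual_ip_riesz[OF hilbert_on]
  show "fspace.subspace (dual_space V B)"
    unfolding dual_space_eq_riesz_image fspace.subspace_def
    by (auto simp: riesz_add riesz_scale) (metis image_eqI riesz_zero zero_mem)
  have "riesz V B f \<noteq> 0 \<Longrightarrow> f \<noteq> 0" for f
    using riesz_zero by auto
  then show "pos_def_form_on (dual_space V B) (dual_ip V B)"
    unfolding dual_space_eq_riesz_image pos_def_form_on_def sesquilinear_on_def linear_on_def
    by (auto simp: riesz_add riesz_scale ip form_simps form_self_pos
        intro: form_cnj) (metis form_self Reals_of_real)
qed

end

section \<open>Holomorphic functions of several variables\<close>

lemma holomorphic_fun_continuous_on: "holomorphic_fun X f \<Longrightarrow> continuous_on X f"
  unfolding holomorphic_fun_def
  by (meson continuous_at_imp_continuous_on has_derivative_continuous)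

lemma norm_vector_scalar_mult: "norm (c *s v) = cmod c * norm (v :: complex ^ 'n)"
  by (simp add: norm_vec_def norm_mult L2_set_right_distrib)

text \<open>By the chain rule and complex homogeneity of \<open>D\<close>, the derivative along the
  line is multiplication by \<open>D v\<close>.\<close>

lemma holomorphic_fun_line:
  fixes X :: "(complex ^ 'n) set"
  assumes f: "holomorphic_fun X f" and S: "\<And>z. z \<in> S \<Longrightarrow> y + z *s v \<in> X"
  shows "(\<lambda>z. f (y + z *s v)) holomorphic_on S"
  unfolding holomorphic_on_def
proof
  fix z assume "z \<in> S"
  with f S obtain D where D: "(f has_derivative D) (at (y + z *s v))" "\<And>c w. D (c *s w) = c * D w"
    unfolding holomorphic_fun_def by blast
  have "linear (\<lambda>z. z *s v)"
    by (intro linearI) (simp_all add: vec_eq_iff algebra_simps)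
  then have "((\<lambda>z. y + z *s v) has_derivative (\<lambda>z. z *s v)) (at z within S)"
    by (auto intro!: derivative_eq_intros bounded_linear_imp_has_derivative simp: linear_conv_bounded_linear)
  from has_derivative_compose[OF this D(1)]
  have "((\<lambda>z. f (y + z *s v)) has_derivative (\<lambda>z. D v * z)) (at z within S)"
    by (simp add: D(2) mult.commute)
  then show "(\<lambda>z. f (y + z *s v)) field_differentiable at z within S"
    unfolding field_differentiable_def has_field_derivative_def by blast
qed

text \<open>The one-variable maximum principle is applied on the complex line through
  \<open>y\<close> and \<open>x\<close>, with parameters 0 at \<open>y\<close> and 1 at
  \<open>x\<close>.\<close>

lemma holomorphic_fun_maximum_modulus:
  fixes X :: "(complex ^ 'n) set"
  assumes f: "holomorphic_fun X f" and e: "ball y e \<subseteq> X" and x: "x \<in> ball y e"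
    and max: "\<And>x. x \<in> X \<Longrightarrow> cmod (f x) \<le> cmod (f y)"
  shows "f x = f y"
proof (cases "x = y")
  case False
  define v where "v = x - y"
  \<comment> \<open>The disc of radius \<open>r\<close> parametrizes the part of the line inside
    \<open>ball y e\<close>; \<open>r > 1\<close> puts \<open>x\<close> there.\<close>
  define r where "r = e / norm v"
  have v: "norm v > 0" "norm v < e"
    using False x by (auto simp: v_def dist_norm norm_minus_commute)
  have r: "r > 1"
    using v by (simp add: r_def)
  have mem: "y + z *s v \<in> X" if "z \<in> ball 0 r" for z
    using that v e by (auto simp: r_def dist_norm norm_vector_scalar_mult field_simps)
  have "(\<lambda>z. f (y + z *s v)) constant_on ball 0 r"
    by (rule maximum_modulus_principle[where \<xi> = 0 and U = "ball 0 r"])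
      (use r max mem in \<open>auto intro!: holomorphic_fun_line[OF f]\<close>)
  then have "f (y + 1 *s v) = f (y + 0 *s v)"
    using r unfolding constant_on_def by (metis centre_in_ball mem_ball_0 norm_one zero_less_one
        less_trans)
  then show ?thesis
    by (simp add: v_def)
qed simp

section \<open>Constancy of the functions in \<open>F\<close>\<close>

theorem proposition3p11:
  fixes X :: "(complex ^ 'n) set"
    and F :: "(complex ^ 'n \<Rightarrow> complex) set"
    and ip :: "(complex ^ 'n \<Rightarrow> complex) \<Rightarrow> (complex ^ 'n \<Rightarrow> complex) \<Rightarrow> complex"
    and \<sigma> :: "((complex ^ 'n \<Rightarrow> complex) \<Rightarrow> complex) \<Rightarrow> ((complex ^ 'n \<Rightarrow> complex) \<Rightarrow> complex) \<Rightarrow>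
              ((complex ^ 'n \<Rightarrow> complex) \<Rightarrow> complex) \<Rightarrow> complex"
  assumes "open X" and "connected X" and "weakly_symmetric X"
    and "rkhs X F ip"
    and "\<forall>f\<in>F. holomorphic_fun X f"
    and "\<forall>f\<in>F. \<forall>\<Phi>\<in>Aut X. composition_op X \<Phi> f \<in> F"
    and "hermitean_metric (dual_space F ip) (dual_ip F ip) \<sigma>"
    and "unitary_invariant (dual_space F ip) (dual_ip F ip) \<sigma>"
    and "\<forall>\<Phi>\<in>Aut X. metric_invariant (dual_space F ip) \<sigma> (adjoint_op F (composition_op X \<Phi>))"
  shows "\<forall>f\<in>F. f constant_on X"
proof -
  have hilbert: "hilbert_on F ip"
    using assms(4) by (simp add: rkhs_def)
  interpret hilbert_space F ip
    by (rule hilbert_space_if_hilbert_on[OF hilbert])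
  define W where "W = dual_space F ip"
  define d where "d = dual_ip F ip"
  interpret W: pos_def_space W d
    unfolding W_def d_def by (rule pos_def_space_dual)
  obtain K' where K': "\<forall>x\<in>X. (\<lambda>y. K' y x) \<in> F \<and> (\<forall>f\<in>F. f x = ip f (\<lambda>y. K' y x))"
    using assms(4) unfolding rkhs_def by blast
  \<comment> \<open>\<open>K x\<close> is the section K(\<cdot>, x), so \<open>K x y\<close> stands
    for K(y, x).\<close>
  define K where "K x = (\<lambda>y. K' y x)" for x
  have K: "K x \<in> F" "\<And>f. f \<in> F \<Longrightarrow> ip f (K x) = f x" if "x \<in> X" for x
    using K' that by (auto simp: K_def)
  define \<delta> where "\<delta> x = riesz F ip (K x)" for x
  have \<delta>: "\<delta> x \<in> W" if "x \<in> X" for x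
    using K(1)[OF that] by (simp add: \<delta>_def W_def riesz_mem)
  \<comment> \<open>The dual inner product is \<open>ip (K y) (K x)\<close>, evaluated by the
    reproducing property.\<close>
  have d: "d (\<delta> x) (\<delta> y) = K y x" if "x \<in> X" "y \<in> X" for x y
    using that K by (simp add: d_def \<delta>_def dual_ip_riesz[OF hilbert])
  have K_cnj: "K y x = cnj (K x y)" if "x \<in> X" "y \<in> X" for x y
    using form_cnj[of "K x" "K y"] K that by simp
  have \<delta>_eq_0: "\<delta> x = 0 \<longleftrightarrow> (\<forall>f\<in>F. f x = 0)" if "x \<in> X" for x
    using K that by (auto simp: \<delta>_def riesz_def fun_eq_iff)
  \<comment> \<open>Both sides send \<open>f\<close> to \<open>f (\<Phi> x)\<close>; closure of
    \<open>F\<close> under composition matters, as \<open>\<delta> x\<close> is 0 off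
    \<open>F\<close>.\<close>
  have adj: "adjoint_op F (composition_op X \<Phi>) (\<delta> x) = \<delta> (\<Phi> x)"
    if "\<Phi> \<in> Aut X" "x \<in> X" "\<Phi> x \<in> X" for \<Phi> x
    using that assms(6) K
    by (auto simp: adjoint_op_def \<delta>_def riesz_def fun_eq_iff composition_op_def)
  \<comment> \<open>The metric only has base points other than 0. If some evaluation vanishes,
    automorphisms carry this to every point and all functions in \<open>F\<close> are 0 on
    \<open>X\<close>.\<close>
  show ?thesis
  proof (cases "\<exists>x\<in>X. \<delta> x = 0")
    case True
    then obtain x where x: "x \<in> X" "\<delta> x = 0" by blast
    have "f y = 0" if f: "f \<in> F" and y: "y \<in> X" for f y
    proof -
      obtain \<Phi> where \<Phi>: "\<Phi> \<in> Aut X" "\<Phi> x = y"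
        using assms(3) x(1) y unfolding weakly_symmetric_def by blast
      then have "composition_op X \<Phi> f x = 0"
        using assms(6) x f \<delta>_eq_0 by blast
      then show ?thesis
        using \<Phi> x by (simp add: composition_op_def)
    qed
    then show ?thesis
      by (auto simp: constant_on_def)
  next
    case False
    then have \<delta>0: "\<delta> x \<noteq> 0" if "x \<in> X" for x
      using that by blast
    have Kxx: "K x x \<noteq> 0" if "x \<in> X" for x
      using d[OF that that] W.form_self_eq_0_iff[OF \<delta>[OF that]] \<delta>0[OF that] by simp
    have \<sigma>: "pos_def_form_on W (\<sigma> g)" if "g \<in> W" "g \<noteq> 0" for g
      using assms(7) that by (auto simp: hermitean_metric_def W_def)
    have formula: "\<sigma> (\<delta> x) (\<delta> y) (\<delta> x) = K x y / K x x * \<sigma> (\<delta> x) (\<delta> x) (\<delta> x)"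
      if "x \<in> X" "y \<in> X" for x y
      using W.unitary_invariant_form[of \<sigma> "\<delta> x" "\<delta> y"] assms(8) \<sigma> \<delta> \<delta>0 that
      by (simp add: d flip: W_def d_def)
    have diag: "K y y = K x x" if x: "x \<in> X" and y: "y \<in> X" and xy: "K x y \<noteq> 0" for x y
    proof -
      obtain \<Phi> where \<Phi>: "\<Phi> \<in> Aut X" "\<Phi> x = y" "\<Phi> y = x"
        using assms(3) x y unfolding weakly_symmetric_def by blast
      define T where "T = adjoint_op F (composition_op X \<Phi>)"
      have T: "T (\<delta> x) = \<delta> y" "T (\<delta> y) = \<delta> x"
        using adj[of \<Phi> x] adj[of \<Phi> y] \<Phi> x y by (simp_all add: T_def)
      have "metric_invariant W \<sigma> T"
        using assms(9) \<Phi> by (simp add: W_def T_def)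
      then have inv: "\<sigma> (T (\<delta> x)) (T f) (T h) = \<sigma> (\<delta> x) f h" if "f \<in> W" "h \<in> W" for f h
        using \<delta>[OF x] \<delta>0[OF x] that by (simp add: metric_invariant_def)
      have eq1: "\<sigma> (\<delta> y) (\<delta> y) (\<delta> y) = \<sigma> (\<delta> x) (\<delta> x) (\<delta> x)"
        using inv[of "\<delta> x" "\<delta> x"] \<delta> x T by simp
      have eq2: "\<sigma> (\<delta> y) (\<delta> x) (\<delta> y) = \<sigma> (\<delta> x) (\<delta> y) (\<delta> x)"
        using inv[of "\<delta> y" "\<delta> x"] \<delta> x y T by simp
      interpret \<sigma>: pos_def_space W "\<sigma> (\<delta> x)"
        by unfold_locales (use W.subspace \<sigma> \<delta> \<delta>0 x in auto)
      have "\<sigma> (\<delta> x) (\<delta> x) (\<delta> x) \<noteq> 0"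
        using \<sigma>.form_self_eq_0_iff \<delta> \<delta>0 x by blast
      \<comment> \<open>Apply \<open>formula\<close> to both sides of \<open>eq2\<close> and cancel
        the nonzero factor \<open>\<sigma> (\<delta> x) (\<delta> x) (\<delta> x)\<close>, common by
        \<open>eq1\<close>.\<close>
      then have "K y x / K y y = K x y / K x x"
        using eq2 unfolding formula[OF x y] formula[OF y x] eq1 by (metis mult_right_cancel)
      then have "cmod (K y x / K y y) = cmod (K x y / K x x)"
        by simp
      moreover have "cmod (K y x) = cmod (K x y)"
        using K_cnj[OF x y] by simp
      ultimately have "cmod (K y y) = cmod (K x x)"
        using xy Kxx x y by (simp add: norm_divide field_simps)
      \<comment> \<open>Diagonal values are squared norms, so equal moduli mean equal
        values.\<close>
      moreover have "K z z = of_real (cmod (K z z))" if z: "z \<in> X" for z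
        using form_self[of "K z"] form_self_nonneg[of "K z"] K z by (metis norm_of_real abs_of_nonneg)
      ultimately show ?thesis
        using x y by metis
    qed
    have "(\<lambda>x. K x x) constant_on X"
    proof (rule locally_constant_imp_constant[OF assms(2)])
      fix x assume x: "x \<in> X"
      \<comment> \<open>\<open>K x\<close> lies in \<open>F\<close>, so it is continuous and the set
        where \<open>diag\<close> applies is an open neighbourhood of \<open>x\<close>.\<close>
      have "continuous_on X (K x)"
        using holomorphic_fun_continuous_on[of X "K x"] assms(5) K(1)[OF x] by simp
      then have "open {y \<in> X. K x y \<noteq> 0}"
        using continuous_open_preimage[of X "K x" "- {0}"] assms(1)
        by (simp add: vimage_def Int_def open_Compl)
      then have "openin (top_of_set X) {y \<in> X. K x y \<noteq> 0}"
        by (intro open_subset) auto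
      moreover have "x \<in> {y \<in> X. K x y \<noteq> 0}"
        using x Kxx[OF x] by simp
      moreover have "\<forall>y\<in>{y \<in> X. K x y \<noteq> 0}. K y y = K x x"
        using diag[OF x] by blast
      ultimately show "\<exists>T. openin (top_of_set X) T \<and> x \<in> T \<and> (\<forall>y\<in>T. K y y = K x x)"
        by blast
    qed
    then obtain c where c: "\<And>x. x \<in> X \<Longrightarrow> K x x = c"
      unfolding constant_on_def by blast
    have loc: "f x = f y" if y: "y \<in> X" and e: "ball y e \<subseteq> X" "x \<in> ball y e" and f: "f \<in> F" for x y e f
    proof -
      have x: "x \<in> X" using e by blast
      \<comment> \<open>In Cauchy-Schwarz both squared norms equal \<open>c\<close>, so
        \<open>K y\<close> attains its maximum modulus at \<open>y\<close>.\<close>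
      have "cmod (K y z) \<le> cmod (K y y)" if z: "z \<in> X" for z
      proof (rule power2_le_imp_le)
        show "(cmod (K y z))\<^sup>2 \<le> (cmod (K y y))\<^sup>2"
        proof -
          have "(cmod (K y z))\<^sup>2 = (cmod (ip (K y) (K z)))\<^sup>2"
            using K(2)[OF z K(1)[OF y]] by simp
          also have "\<dots> \<le> Re (ip (K y) (K y)) * Re (ip (K z) (K z))"
            by (rule Cauchy_Schwarz[OF K(1)[OF y] K(1)[OF z]])
          also have "\<dots> = (Re (K y y))\<^sup>2"
            using c[OF y] c[OF z] K(2)[OF y K(1)[OF y]] K(2)[OF z K(1)[OF z]]
            by (simp add: power2_eq_square)
          also have "\<dots> \<le> (cmod (K y y))\<^sup>2"
            using abs_Re_le_cmod[of "K y y"] by (metis abs_ge_zero power2_abs power_mono)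
          finally show ?thesis .
        qed
      qed simp
      then have "K y x = K y y"
        using holomorphic_fun_maximum_modulus[of X "K y" y e x] assms(5) K(1)[OF y] e by simp
      moreover from this have "K x y = K y y"
        using K_cnj[OF y x] K_cnj[OF y y] by metis
      \<comment> \<open>The four terms of the expansion are all \<open>c\<close> up to sign and
        cancel.\<close>
      ultimately have "ip (K x - K y) (K x - K y) = 0"
        using K(1)[OF x] K(1)[OF y] K(2)[OF x] K(2)[OF y] c[OF x] c[OF y] by (simp add: form_simps)
      then have "K x = K y"
        using form_self_eq_0_iff[of "K x - K y"] K(1)[OF x] K(1)[OF y] by simp
      then show ?thesis
        using K(2)[OF x f] K(2)[OF y f] by simp
    qed
    show ?thesis
    proof
      fix f assume f: "f \<in> F"
      show "f constant_on X"
      proof (rule locally_constant_imp_constant[OF assms(2)])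
        fix y assume y: "y \<in> X"
        then obtain e where e: "e > 0" "ball y e \<subseteq> X"
          using assms(1) open_contains_ball by blast
        have "\<forall>x\<in>ball y e. f x = f y"
          using loc[OF y e(2) _ f] by blast
        moreover have "openin (top_of_set X) (ball y e)" "y \<in> ball y e"
          using e by (auto intro: open_subset)
        ultimately show "\<exists>T. openin (top_of_set X) T \<and> y \<in> T \<and> (\<forall>x\<in>T. f x = f y)"
          by blast
      qed
    qed
  qed
qed

end
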